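(* Let $(X,\mu,\ast)$ be a fuzzy metric space and let $A,B,I:X\to X$ be three self-mappings of $X$ such that: (i) the pairs $\{A,I\}$ and $\{B,I\}$ are weakly compatible; (ii) the mappings $A$, $B$ and $I$ satisfy the property (E.A.), i.e. there is a sequence $(x_n)$ in $X$ and a point $u\in X$ such that $\lim_{n\to\infty}Ax_n=\lim_{n\to\infty}Bx_n=\lim_{n\to\infty}Ix_n=u$; (iii) for all $x\neq y$ in $X$ and all $t>0$, $$F\big(\mu(Ax,By,t),\ \mu(Ix,Iy,t),\ \mu(Ix,Ax,t),\ \mu(Iy,By,t),\ \mu(Ix,By,t),\ \mu(Iy,Ax,t)\big)\le 1,$$ where $F:[0,1]^6\to\mathbb{R}$ is a continuous function satisfying properties $(F_1)$, $(F_2)$ and $(F_3)$; (iv) $I(X)$ is a closed subset of $X$. Then the mappings $A$, $B$ and $I$ have a unique common fixed point, i.e. there is exactly one $x\in X$ with $Ax=Bx=Ix=x$.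
   Context: Continuous t-norm: a binary operation $\ast:[0,1]\times[0,1]\to[0,1]$ that is commutative, associative, continuous, satisfies $a\ast 1=a$ for all $a\in[0,1]$, and satisfies $a\ast b\le c\ast d$ whenever $a\le c$, $b\le d$ ($a,b,c,d\in[0,1]$). Fuzzy metric space: a triple $(X,\mu,\ast)$ where $X$ is a set, $\ast$ is a continuous t-norm and $\mu:X^2\times(0,\infty)\to[0,1]$ satisfies, for all $x,y,z\in X$ and $s,t>0$: (i) $\mu(x,y,t)>0$; (ii) $\mu(x,y,t)=1$ if and only if $x=y$; (iii) $\mu(x,y,t)=\mu(y,x,t)$; (iv) $\mu(x,y,s)\ast\mu(y,z,t)\le\mu(x,z,s+t)$; (v) $\mu(x,y,\cdot):(0,\infty)\to(0,1]$ is continuous. Convergence: $x_n\to x$ means $\lim_{n\to\infty}\mu(x_n,x,t)=1$ for every $t>0$. A subset $P\subseteq X$ is closed if whenever a sequence in $P$ converges to $x\in X$, then $x\in P$. Weak compatibility: self-maps $A$ and $B$ of $X$ are weakly compatible if they commute at their coincidence points: $Az=Bz$ implies $ABz=BAz$. Properties of $F$ (a continuous function on $[0,1]^6$): $(F_1)$ $F(u(t),1,1,u(t),u(t),1)>1$ for all $t>0$ with $0\le u(t)<1$; $(F_2)$ $F(u(t),1,u(t),1,1,u(t))>1$ for all $t>0$ with $0\le u(t)<1$; $(F_3)$ $F(u(t),u(t),1,1,u(t),u(t))>1$ for all $t>0$ with $0\le u(t)<1$. (That is, for every real number $u\in[0,1)$ in place of $u(t)$.) *)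

theory Defs
  imports "HOL-Analysis.Analysis"
begin

locale continuous_t_norm =
  fixes T :: "real \<Rightarrow> real \<Rightarrow> real"
  assumes t_norm_range: "\<lbrakk>a \<in> {0..1}; b \<in> {0..1}\<rbrakk> \<Longrightarrow> T a b \<in> {0..1}"
    and t_norm_commute: "\<lbrakk>a \<in> {0..1}; b \<in> {0..1}\<rbrakk> \<Longrightarrow> T a b = T b a"
    and t_norm_assoc:
      "\<lbrakk>a \<in> {0..1}; b \<in> {0..1}; c \<in> {0..1}\<rbrakk> \<Longrightarrow> T (T a b) c = T a (T b c)"
    and t_norm_continuous: "continuous_on ({0..1} \<times> {0..1}) (\<lambda>(a, b). T a b)"
    and t_norm_one: "a \<in> {0..1} \<Longrightarrow> T a 1 = a"
    and t_norm_mono: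
      "\<lbrakk>a \<in> {0..1}; b \<in> {0..1}; c \<in> {0..1}; d \<in> {0..1}; a \<le> c; b \<le> d\<rbrakk>
        \<Longrightarrow> T a b \<le> T c d"

text \<open>
  Fuzzy metric spaces in the sense of George and Veeramani.  The space is a carrier
  set \<open>X\<close>; nothing is required of \<open>\<mu>\<close> outside \<open>X \<times> X \<times> (0, \<infinity>)\<close>.
\<close>

locale fuzzy_metric_space = continuous_t_norm T
  for X :: "'a set" and \<mu> :: "'a \<Rightarrow> 'a \<Rightarrow> real \<Rightarrow> real" and T :: "real \<Rightarrow> real \<Rightarrow> real" +
  assumes range: "\<lbrakk>x \<in> X; y \<in> X; t > 0\<rbrakk> \<Longrightarrow> \<mu> x y t \<in> {0..1}"
    and positive: "\<lbrakk>x \<in> X; y \<in> X; t > 0\<rbrakk> \<Longrightarrow> \<mu> x y t > 0"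
    and eq_one_iff: "\<lbrakk>x \<in> X; y \<in> X; t > 0\<rbrakk> \<Longrightarrow> \<mu> x y t = 1 \<longleftrightarrow> x = y"
    and symmetric: "\<lbrakk>x \<in> X; y \<in> X; t > 0\<rbrakk> \<Longrightarrow> \<mu> x y t = \<mu> y x t"
    and triangle: "\<lbrakk>x \<in> X; y \<in> X; z \<in> X; s > 0; t > 0\<rbrakk>
      \<Longrightarrow> T (\<mu> x y s) (\<mu> y z t) \<le> \<mu> x z (s + t)"
    and continuous: "\<lbrakk>x \<in> X; y \<in> X\<rbrakk> \<Longrightarrow> continuous_on {0<..} (\<mu> x y)"

definition fuzzy_converges ::
  "('a \<Rightarrow> 'a \<Rightarrow> real \<Rightarrow> real) \<Rightarrow> (nat \<Rightarrow> 'a) \<Rightarrow> 'a \<Rightarrow> bool" where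
  "fuzzy_converges \<mu> s x \<longleftrightarrow> (\<forall>t>0. (\<lambda>n. \<mu> (s n) x t) \<longlonglongrightarrow> 1)"

definition fuzzy_closed ::
  "'a set \<Rightarrow> ('a \<Rightarrow> 'a \<Rightarrow> real \<Rightarrow> real) \<Rightarrow> 'a set \<Rightarrow> bool" where
  "fuzzy_closed X \<mu> P \<longleftrightarrow>
    P \<subseteq> X \<and> (\<forall>s x. (\<forall>n. s n \<in> P) \<and> x \<in> X \<and> fuzzy_converges \<mu> s x \<longrightarrow> x \<in> P)"

definition weakly_compatible :: "'a set \<Rightarrow> ('a \<Rightarrow> 'a) \<Rightarrow> ('a \<Rightarrow> 'a) \<Rightarrow> bool" where
  "weakly_compatible X A B \<longleftrightarrow> (\<forall>z\<in>X. A z = B z \<longrightarrow> A (B z) = B (A z))"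

definition property_EA :: "'a set \<Rightarrow> ('a \<Rightarrow> 'a \<Rightarrow> real \<Rightarrow> real) \<Rightarrow>
    ('a \<Rightarrow> 'a) \<Rightarrow> ('a \<Rightarrow> 'a) \<Rightarrow> ('a \<Rightarrow> 'a) \<Rightarrow> bool" where
  "property_EA X \<mu> A B I \<longleftrightarrow>
    (\<exists>x u. (\<forall>n. x n \<in> X) \<and> u \<in> X \<and>
      fuzzy_converges \<mu> (\<lambda>n. A (x n)) u \<and>
      fuzzy_converges \<mu> (\<lambda>n. B (x n)) u \<and>
      fuzzy_converges \<mu> (\<lambda>n. I (x n)) u)"

type_synonym real6 = "real \<times> real \<times> real \<times> real \<times> real \<times> real"

abbreviation unit_cube6 :: "real6 set" where
  "unit_cube6 \<equiv> {0..1} \<times> {0..1} \<times> {0..1} \<times> {0..1} \<times> {0..1} \<times> {0..1}"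

text \<open>
  In the literature these properties are written with \<open>u(t)\<close> for \<open>t > 0\<close>; only the value
  \<open>u = u(t)\<close> in \<open>[0, 1)\<close> enters.
\<close>

definition property_F1 :: "(real6 \<Rightarrow> real) \<Rightarrow> bool" where
  "property_F1 F \<longleftrightarrow> (\<forall>u. 0 \<le> u \<and> u < 1 \<longrightarrow> F (u, 1, 1, u, u, 1) > 1)"

definition property_F2 :: "(real6 \<Rightarrow> real) \<Rightarrow> bool" where
  "property_F2 F \<longleftrightarrow> (\<forall>u. 0 \<le> u \<and> u < 1 \<longrightarrow> F (u, 1, u, 1, 1, u) > 1)"

definition property_F3 :: "(real6 \<Rightarrow> real) \<Rightarrow> bool" where
  "property_F3 F \<longleftrightarrow> (\<forall>u. 0 \<le> u \<and> u < 1 \<longrightarrow> F (u, u, 1, 1, u, u) > 1)"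

end

theory Submission imports Defs begin

text \<open>
  The property (E.A.) gives a sequence \<open>x\<close> along which \<open>A\<close>, \<open>B\<close> and \<open>I\<close> have a common limit \<open>u\<close>,
  and closedness of the image of \<open>I\<close> lets one write \<open>u = I v\<close>.  Comparing \<open>v\<close> with \<open>x n\<close> in the
  implicit relation and letting \<open>n\<close> tend to infinity turns its six arguments into the pattern of
  \<open>F\<^sub>2\<close> with value \<open>\<mu> (A v) u t\<close>, or, with the roles of the two points exchanged, into the pattern of
  \<open>F\<^sub>1\<close> with value \<open>\<mu> u (B v) t\<close>.  These values must be \<open>1\<close>, so \<open>v\<close> is a coincidence point
  of all three maps.  By weak compatibility \<open>A u = I u = B u\<close>.  From here on no
  limits are needed: comparing \<open>u\<close> with \<open>v\<close>, and later two common fixed points with each other,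
  gives the pattern of \<open>F\<^sub>3\<close>, hence \<open>A u = u\<close> and uniqueness.

  The analytic content is the passage to the limit.  It rests on the joint continuity of \<open>\<mu>\<close> in its
  two point arguments (\<open>mu_tendsto\<close>), which is not an axiom of fuzzy metric spaces but follows from
  the triangle inequality, the uniform continuity of the t-norm near \<open>1\<close>, and continuity in \<open>t\<close>.
  A second, smaller point is that the implicit relation is assumed for distinct points only, whereas
  \<open>x\<close> might return to \<open>v\<close> infinitely often; but that forces the equality \<open>A v = u\<close> (or \<open>B v = u\<close>)
  being proved (\<open>eventually_avoids\<close>).
\<close>

section \<open>Joint continuity of a fuzzy metric\<close>

text \<open>
  Multiplying by something close to \<open>1\<close> decreases \<open>c\<close> little, uniformly in \<open>c\<close>, because \<open>T\<close> is
  uniformly continuous on the compact unit square.  Uniformity matters since \<open>c\<close> will be a distance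
  between moving points.
\<close>

lemma (in continuous_t_norm) near_unit:
  assumes "e > 0"
  obtains d where "d > 0"
    "\<And>p c. \<lbrakk>p \<in> {0..1}; c \<in> {0..1}; p > 1 - d\<rbrakk> \<Longrightarrow> T p c > c - e"
proof -
  have "uniformly_continuous_on ({0..1} \<times> {0..1}) (\<lambda>(a, b). T a b)"
    by (intro compact_uniformly_continuous t_norm_continuous compact_Times compact_Icc)
  then obtain d where d: "d > 0" and
    close: "\<And>z z'. \<lbrakk>z \<in> {0..1} \<times> {0..1}; z' \<in> {0..1} \<times> {0..1}; dist z' z < d\<rbrakk>
      \<Longrightarrow> dist (case z' of (a, b) \<Rightarrow> T a b) (case z of (a, b) \<Rightarrow> T a b) < e"
    using assms unfolding uniformly_continuous_on_def by blast
  show thesis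
  proof (rule that[OF d])
    fix p c :: real
    assume p: "p \<in> {0..1}" and c: "c \<in> {0..1}" and pd: "p > 1 - d"
    have "dist (p, c) (1, c) < d"
      using p pd by (simp add: dist_Pair_Pair dist_real_def)
    then have "dist (T p c) (T 1 c) < e"
      using close[of "(1, c)" "(p, c)"] p c by simp
    moreover have "T 1 c = c"
      using t_norm_commute[of 1 c] t_norm_one[OF c] c by simp
    ultimately show "T p c > c - e"
      by (simp add: dist_real_def)
  qed
qed

lemma (in continuous_t_norm) near_unit_both_sides:
  assumes "e > 0"
  obtains d where "d > 0"
    "\<And>p c q. \<lbrakk>p \<in> {0..1}; c \<in> {0..1}; q \<in> {0..1}; p > 1 - d; q > 1 - d\<rbrakk>
      \<Longrightarrow> T (T p c) q > c - e"
proof -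
  from assms have "e / 2 > 0" by simp
  then obtain d where d: "d > 0" and
    *: "\<And>p c. \<lbrakk>p \<in> {0..1}; c \<in> {0..1}; p > 1 - d\<rbrakk> \<Longrightarrow> T p c > c - e / 2"
    using near_unit by blast
  show thesis
  proof (rule that[OF d])
    fix p c q :: real
    assume a: "p \<in> {0..1}" "c \<in> {0..1}" "q \<in> {0..1}" "p > 1 - d" "q > 1 - d"
    have "T q (T p c) > T p c - e / 2" "T p c > c - e / 2"
      using *[of q "T p c"] *[of p c] t_norm_range[of p c] a by auto
    then show "T (T p c) q > c - e"
      using t_norm_commute[of "T p c" q] t_norm_range[of p c] a by linarith
  qed
qed

context fuzzy_metric_space
begin

lemma quadrilateral:
  assumes "p \<in> X" "q \<in> X" "r \<in> X" "w \<in> X" "h > 0" "s > 0"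
  shows "T (T (\<mu> p q h) (\<mu> q r s)) (\<mu> r w h) \<le> \<mu> p w (s + 2 * h)"
proof -
  have "T (T (\<mu> p q h) (\<mu> q r s)) (\<mu> r w h) \<le> T (\<mu> p r (h + s)) (\<mu> r w h)"
    using assms triangle[of p q r h s]
    by (intro t_norm_mono t_norm_range range) auto
  also have "\<dots> \<le> \<mu> p w (h + s + h)"
    using assms by (intro triangle) auto
  finally show ?thesis by (simp add: algebra_simps)
qed

text \<open>
  The quadrilateral inequality compares \<open>\<mu> (a n) (b n)\<close> at time \<open>t\<close> with \<open>\<mu> x y\<close> at the times
  \<open>t - 2 * h\<close> from below and \<open>t + 2 * h\<close> from above, each up to factors that tend to \<open>1\<close>;
  continuity of \<open>\<mu> x y\<close> in time then allows \<open>h\<close> to be taken small.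
\<close>

lemma mu_tendsto:
  assumes X: "\<And>n. a n \<in> X" "\<And>n. b n \<in> X" "x \<in> X" "y \<in> X"
    and a: "fuzzy_converges \<mu> a x" and b: "fuzzy_converges \<mu> b y" and t: "t > 0"
  shows "(\<lambda>n. \<mu> (a n) (b n) t) \<longlonglongrightarrow> \<mu> x y t"
proof (rule tendstoI)
  fix e :: real assume "e > 0"
  then have e2: "e / 2 > 0" by simp
  have "isCont (\<mu> x y) t"
    using continuous[OF X(3,4)] t by (simp add: continuous_on_eq_continuous_at)
  then obtain k where k: "k > 0" "\<And>s. dist s t < k \<Longrightarrow> dist (\<mu> x y s) (\<mu> x y t) < e / 2"
    using e2 unfolding continuous_at_eps_delta dist_real_def by blast
  define h where "h = min k t / 4"
  have h: "h > 0" "2 * h < k" "2 * h < t"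
    using k(1) t by (auto simp: h_def)
  have "\<bar>\<mu> x y (t - 2 * h) - \<mu> x y t\<bar> < e / 2" "\<bar>\<mu> x y (t + 2 * h) - \<mu> x y t\<bar> < e / 2"
    using k(2)[of "t - 2 * h"] k(2)[of "t + 2 * h"] h by (simp_all add: dist_real_def)
  then have lo: "\<mu> x y (t - 2 * h) > \<mu> x y t - e / 2"
    and hi: "\<mu> x y (t + 2 * h) < \<mu> x y t + e / 2"
    by linarith+
  obtain d where d: "d > 0" and
    near: "\<And>p c q. \<lbrakk>p \<in> {0..1}; c \<in> {0..1}; q \<in> {0..1}; p > 1 - d; q > 1 - d\<rbrakk>
      \<Longrightarrow> T (T p c) q > c - e / 2"
    using near_unit_both_sides[OF e2] by blast
  have "(\<lambda>n. \<mu> (a n) x h) \<longlonglongrightarrow> 1" "(\<lambda>n. \<mu> (b n) y h) \<longlonglongrightarrow> 1"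
    using a b h(1) unfolding fuzzy_converges_def by auto
  then have "eventually (\<lambda>n. \<mu> (a n) x h > 1 - d) sequentially"
    "eventually (\<lambda>n. \<mu> (b n) y h > 1 - d) sequentially"
    using d by (auto intro: order_tendstoD(1))
  then show "eventually (\<lambda>n. dist (\<mu> (a n) (b n) t) (\<mu> x y t) < e) sequentially"
  proof eventually_elim
    case (elim n)
    have sym: "\<mu> x (a n) h = \<mu> (a n) x h" "\<mu> y (b n) h = \<mu> (b n) y h"
      using symmetric X h(1) by auto
    have "\<mu> x y (t - 2 * h) - e / 2 < T (T (\<mu> (a n) x h) (\<mu> x y (t - 2 * h))) (\<mu> y (b n) h)"
      using elim h X sym by (intro near range) auto
    also have "\<dots> \<le> \<mu> (a n) (b n) t"
      using quadrilateral[of "a n" x y "b n" h "t - 2 * h"] X h by simp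
    finally have 1: "\<mu> x y (t - 2 * h) - e / 2 < \<mu> (a n) (b n) t" .
    have "\<mu> (a n) (b n) t - e / 2 < T (T (\<mu> x (a n) h) (\<mu> (a n) (b n) t)) (\<mu> (b n) y h)"
      using elim h X sym t by (intro near range) auto
    also have "\<dots> \<le> \<mu> x y (t + 2 * h)"
      using quadrilateral[of x "a n" "b n" y h t] X h t by simp
    finally have 2: "\<mu> (a n) (b n) t - e / 2 < \<mu> x y (t + 2 * h)" .
    from 1 2 lo hi show ?case by (simp add: dist_real_def)
  qed
qed

lemma fuzzy_converges_const:
  assumes "x \<in> X"
  shows "fuzzy_converges \<mu> (\<lambda>_. x) x"
proof -
  have "\<mu> x x t = 1" if "t > 0" for t
    using assms that eq_one_iff by blast
  then show ?thesis
    unfolding fuzzy_converges_def by simp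
qed

lemma less_one:
  assumes "x \<in> X" "y \<in> X" "x \<noteq> y" "t > 0"
  shows "\<mu> x y t < 1"
  using range[OF assms(1,2,4)] eq_one_iff[OF assms(1,2,4)] assms(3) by auto

text \<open>
  If \<open>x n = v\<close> infinitely often, then \<open>f v\<close> occurs infinitely often in a sequence tending to \<open>u\<close>,
  so it must equal \<open>u\<close>.
\<close>

lemma eventually_avoids:
  assumes "fuzzy_converges \<mu> (\<lambda>n. f (x n)) u" "f v \<in> X" "u \<in> X" "f v \<noteq> u"
  shows "eventually (\<lambda>n. x n \<noteq> v) sequentially"
proof -
  have "(\<lambda>n. \<mu> (f (x n)) u 1) \<longlonglongrightarrow> 1"
    using assms(1) unfolding fuzzy_converges_def by simp
  moreover have "\<mu> (f v) u 1 < 1"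
    using assms less_one by simp
  ultimately have "eventually (\<lambda>n. \<mu> (f v) u 1 < \<mu> (f (x n)) u 1) sequentially"
    by (rule order_tendstoD(1))
  then show ?thesis
    by eventually_elim auto
qed

section \<open>Implicit relations between three maps\<close>

text \<open>
  Continuity of \<open>\<mu>\<close> in its points and of \<open>F\<close> on the cube carries the relation over to the limits.
  Stating it for two sequences lets either of them be constant, so that the comparison of \<open>v\<close> with
  a sequence serves for \<open>A\<close> and, with the points exchanged, for \<open>B\<close>.
\<close>

lemma implicit_relation_limit:
  fixes F :: "real6 \<Rightarrow> real"
  assumes F: "continuous_on unit_cube6 F"
    and maps: "A ` X \<subseteq> X" "B ` X \<subseteq> X" "I ` X \<subseteq> X"
    and rel: "\<And>x y t. \<lbrakk>x \<in> X; y \<in> X; x \<noteq> y; t > 0\<rbrakk> \<Longrightarrow>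
      F (\<mu> (A x) (B y) t, \<mu> (I x) (I y) t, \<mu> (I x) (A x) t,
         \<mu> (I y) (B y) t, \<mu> (I x) (B y) t, \<mu> (I y) (A x) t) \<le> 1"
    and pq: "\<And>n. p n \<in> X" "\<And>n. q n \<in> X" "eventually (\<lambda>n. p n \<noteq> q n) sequentially"
    and lim_X: "a \<in> X" "b \<in> X" "i \<in> X" "j \<in> X"
    and lim: "fuzzy_converges \<mu> (\<lambda>n. A (p n)) a" "fuzzy_converges \<mu> (\<lambda>n. B (q n)) b"
      "fuzzy_converges \<mu> (\<lambda>n. I (p n)) i" "fuzzy_converges \<mu> (\<lambda>n. I (q n)) j"
    and t: "t > 0"
  shows "F (\<mu> a b t, \<mu> i j t, \<mu> i a t, \<mu> j b t, \<mu> i b t, \<mu> j a t) \<le> 1"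
proof -
  have in_X: "A (p n) \<in> X" "B (q n) \<in> X" "I (p n) \<in> X" "I (q n) \<in> X" for n
    using maps pq by auto
  define z where "z = (\<lambda>n. (\<mu> (A (p n)) (B (q n)) t, \<mu> (I (p n)) (I (q n)) t,
    \<mu> (I (p n)) (A (p n)) t, \<mu> (I (q n)) (B (q n)) t,
    \<mu> (I (p n)) (B (q n)) t, \<mu> (I (q n)) (A (p n)) t))"
  define l where "l = (\<mu> a b t, \<mu> i j t, \<mu> i a t, \<mu> j b t, \<mu> i b t, \<mu> j a t)"
  have "z \<longlonglongrightarrow> l"
    unfolding z_def l_def by (intro tendsto_Pair mu_tendsto in_X lim_X lim t)
  moreover have "l \<in> unit_cube6" "\<And>n. z n \<in> unit_cube6"
    unfolding z_def l_def mem_Times_iff fst_conv snd_conv by (intro conjI range in_X lim_X t)+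
  ultimately have "(\<lambda>n. F (z n)) \<longlonglongrightarrow> F l"
    by (intro continuous_on_tendsto_compose[OF F]) auto
  moreover have "eventually (\<lambda>n. F (z n) \<le> 1) sequentially"
    using pq(3) unfolding z_def by eventually_elim (intro rel pq t)
  ultimately have "F l \<le> 1"
    by (rule tendsto_upperbound) simp
  then show ?thesis unfolding l_def .
qed

end

section \<open>The common fixed point\<close>

theorem theorem4p1:
  fixes X :: "'a set"
    and \<mu> :: "'a \<Rightarrow> 'a \<Rightarrow> real \<Rightarrow> real"
    and T :: "real \<Rightarrow> real \<Rightarrow> real"
    and A B I :: "'a \<Rightarrow> 'a"
    and F :: "real6 \<Rightarrow> real"
  assumes "fuzzy_metric_space X \<mu> T"
    and "A ` X \<subseteq> X" and "B ` X \<subseteq> X" and "I ` X \<subseteq> X"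
    and "weakly_compatible X A I" and "weakly_compatible X B I"
    and "property_EA X \<mu> A B I"
    and "continuous_on unit_cube6 F"
    and "property_F1 F" and "property_F2 F" and "property_F3 F"
    and "\<And>x y t. \<lbrakk>x \<in> X; y \<in> X; x \<noteq> y; t > 0\<rbrakk> \<Longrightarrow>
      F (\<mu> (A x) (B y) t, \<mu> (I x) (I y) t, \<mu> (I x) (A x) t,
         \<mu> (I y) (B y) t, \<mu> (I x) (B y) t, \<mu> (I y) (A x) t) \<le> 1"
    and "fuzzy_closed X \<mu> (I ` X)"
  shows "\<exists>!x. x \<in> X \<and> A x = x \<and> B x = x \<and> I x = x"
proof -
  interpret fuzzy_metric_space X \<mu> T by fact
  note maps = assms(2-4) and rel = assms(12)
  note limit = implicit_relation_limit[OF \<open>continuous_on unit_cube6 F\<close> maps rel]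
  have self: "\<mu> z z 1 = 1" if "z \<in> X" for z
    using that eq_one_iff[of z z 1] by simp
  have F1: "F (\<mu> y z 1, 1, 1, \<mu> y z 1, \<mu> y z 1, 1) > 1"
    and F2: "F (\<mu> y z 1, 1, \<mu> y z 1, 1, 1, \<mu> y z 1) > 1"
    and F3: "F (\<mu> y z 1, \<mu> y z 1, 1, 1, \<mu> y z 1, \<mu> y z 1) > 1"
    if "y \<in> X" "z \<in> X" "y \<noteq> z" for y z
    using \<open>property_F1 F\<close> \<open>property_F2 F\<close> \<open>property_F3 F\<close> less_one[OF that] positive[OF that(1,2)]
    unfolding property_F1_def property_F2_def property_F3_def by (simp_all add: less_imp_le)
  obtain x u where x: "\<And>n. x n \<in> X" and u: "u \<in> X"
    and Ax: "fuzzy_converges \<mu> (\<lambda>n. A (x n)) u"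
    and Bx: "fuzzy_converges \<mu> (\<lambda>n. B (x n)) u"
    and Ix: "fuzzy_converges \<mu> (\<lambda>n. I (x n)) u"
    using \<open>property_EA X \<mu> A B I\<close> unfolding property_EA_def by blast
  have "u \<in> I ` X"
    using \<open>fuzzy_closed X \<mu> (I ` X)\<close>[unfolded fuzzy_closed_def, THEN conjunct2,
      rule_format, of "\<lambda>n. I (x n)" u] x u Ix by simp
  then obtain v where v: "v \<in> X" and Iv: "I v = u" by blast
  have in_X: "A v \<in> X" "B v \<in> X" "A u \<in> X"
    using maps u v by auto
  have Iv_lim: "fuzzy_converges \<mu> (\<lambda>_. I v) u"
    using fuzzy_converges_const[OF u] Iv by simp

  have Av: "A v = u"
  proof (rule ccontr)
    assume "A v \<noteq> u"
    have ne: "eventually (\<lambda>n. v \<noteq> x n) sequentially"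
      using eventually_avoids[of A x u v, OF Ax in_X(1) u \<open>A v \<noteq> u\<close>] by eventually_elim simp
    have "F (\<mu> (A v) u 1, \<mu> u u 1, \<mu> u (A v) 1, \<mu> u u 1, \<mu> u u 1, \<mu> u (A v) 1) \<le> 1"
      by (rule limit[where p = "\<lambda>_. v" and q = x])
        (use x v u in_X ne Bx Ix Iv_lim fuzzy_converges_const in auto)
    then show False
      using F2[OF u in_X(1)] symmetric[OF u in_X(1), of 1] self[OF u] \<open>A v \<noteq> u\<close> by simp
  qed
  have Bv: "B v = u"
  proof (rule ccontr)
    assume "B v \<noteq> u"
    have ne: "eventually (\<lambda>n. x n \<noteq> v) sequentially"
      by (rule eventually_avoids[of B x u v, OF Bx in_X(2) u \<open>B v \<noteq> u\<close>])
    have "F (\<mu> u (B v) 1, \<mu> u u 1, \<mu> u u 1, \<mu> u (B v) 1, \<mu> u (B v) 1, \<mu> u u 1) \<le> 1"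
      by (rule limit[where p = x and q = "\<lambda>_. v"])
        (use x v u in_X ne Ax Ix Iv_lim fuzzy_converges_const in auto)
    then show False
      using F1[OF u in_X(2)] self[OF u] \<open>B v \<noteq> u\<close> by simp
  qed

  have AIu: "A u = I u" and BIu: "B u = I u"
    using assms(5,6) v Av Bv Iv unfolding weakly_compatible_def by metis+

  \<comment> \<open>Coincidence points of all three maps have the same image: this is where \<open>F\<^sub>3\<close> enters, and it
    gives both existence (applied to \<open>u\<close> and \<open>v\<close>) and uniqueness.\<close>
  have same_image: "I y = I z"
    if "y \<in> X" "z \<in> X" "A y = I y" "B y = I y" "A z = I z" "B z = I z" for y z
  proof (rule ccontr)
    assume ne: "I y \<noteq> I z"
    have IX: "I y \<in> X" "I z \<in> X" using maps that by auto
    have "F (\<mu> (I y) (I z) 1, \<mu> (I y) (I z) 1, 1, 1, \<mu> (I y) (I z) 1, \<mu> (I y) (I z) 1) \<le> 1"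
      using rel[of y z 1] that ne self[OF IX(1)] self[OF IX(2)]
        symmetric[OF IX, of 1] by auto
    then show False
      using F3[OF IX ne] by simp
  qed
  have "I u = u"
    using same_image[OF u v] AIu BIu Av Bv Iv by simp
  then have "u \<in> X \<and> A u = u \<and> B u = u \<and> I u = u"
    using u AIu BIu by simp
  then show ?thesis
    using same_image by metis
qed

end
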